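(* Let $f$ be a harmonic Bloch mapping in $\mathbb{D}$, i.e. $f\in B_h$. Then $$\big|(1-|z|^2)\Lambda_f(z)-(1-|w|^2)\Lambda_f(w)\big|\leq 5.7174\,\rho(z,w)\,\|f\|_{B_h}$$ holds for all $z,w\in\mathbb{D}$.
   Context: $\mathbb{D}=\{z\in\mathbb{C}:|z|<1\}$ is the unit disk. A harmonic mapping in $\mathbb{D}$ is a complex-valued $C^2$ function $f$ on $\mathbb{D}$ with $\Delta f=4f_{z\bar z}=0$, where $f_z=\frac12(f_x-if_y)$ and $f_{\bar z}=\frac12(f_x+if_y)$. Put $\Lambda_f(z)=|f_z(z)|+|f_{\bar z}(z)|$. A harmonic mapping $f$ in $\mathbb{D}$ is called a harmonic Bloch mapping, written $f\in B_h$, if $\|f\|_{B_h}:=\sup_{z\in\mathbb{D}}(1-|z|^2)\Lambda_f(z)<\infty$. The pseudo-hyperbolic distance on $\mathbb{D}$ is $\rho(z,w)=|\varphi_w(z)|$, where $\varphi_w(z)=\frac{w-z}{1-\overline{w}z}$. The constant $5.7174$ is the decimal number as written. *)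

theory Defs
  imports "HOL-Analysis.Analysis"
begin

text \<open>
  Functions on an open subset of the plane are represented as total functions of type
  \<^typ>\<open>complex \<Rightarrow> complex\<close>; the partial derivatives at a point only depend on the values near
  that point, so values outside the open set are irrelevant. Where a partial derivative does not
  exist, the constants below have an unspecified value; existence is part of \<open>C1_on\<close>.
\<close>

definition ddx :: "(complex \<Rightarrow> complex) \<Rightarrow> complex \<Rightarrow> complex" where
  "ddx f z = vector_derivative (\<lambda>t::real. f (z + of_real t)) (at 0)"

definition ddy :: "(complex \<Rightarrow> complex) \<Rightarrow> complex \<Rightarrow> complex" where
  "ddy f z = vector_derivative (\<lambda>t::real. f (z + \<i> * of_real t)) (at 0)"

definition C1_on :: "complex set \<Rightarrow> (complex \<Rightarrow> complex) \<Rightarrow> bool" where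
  "C1_on S f \<longleftrightarrow>
     (\<forall>z\<in>S. (\<lambda>t::real. f (z + of_real t)) differentiable (at 0) \<and>
            (\<lambda>t::real. f (z + \<i> * of_real t)) differentiable (at 0)) \<and>
     continuous_on S (ddx f) \<and> continuous_on S (ddy f)"

definition C2_on :: "complex set \<Rightarrow> (complex \<Rightarrow> complex) \<Rightarrow> bool" where
  "C2_on S f \<longleftrightarrow> C1_on S f \<and> C1_on S (ddx f) \<and> C1_on S (ddy f)"

definition ddz :: "(complex \<Rightarrow> complex) \<Rightarrow> complex \<Rightarrow> complex" where
  "ddz f z = (ddx f z - \<i> * ddy f z) / 2"

definition ddzbar :: "(complex \<Rightarrow> complex) \<Rightarrow> complex \<Rightarrow> complex" where
  "ddzbar f z = (ddx f z + \<i> * ddy f z) / 2"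

text \<open>
  For \<open>C\<^sup>2\<close> functions the mixed partial derivatives agree, so this is the sum of the two pure
  second partial derivatives.
\<close>

definition laplacian :: "(complex \<Rightarrow> complex) \<Rightarrow> complex \<Rightarrow> complex" where
  "laplacian f z = 4 * ddzbar (ddz f) z"

definition harmonic_mapping_on :: "complex set \<Rightarrow> (complex \<Rightarrow> complex) \<Rightarrow> bool" where
  "harmonic_mapping_on S f \<longleftrightarrow> C2_on S f \<and> (\<forall>z\<in>S. laplacian f z = 0)"

definition Lambda :: "(complex \<Rightarrow> complex) \<Rightarrow> complex \<Rightarrow> real" where
  "Lambda f z = norm (ddz f z) + norm (ddzbar f z)"

definition harmonic_Bloch :: "(complex \<Rightarrow> complex) set" where
  "harmonic_Bloch =
     {f. harmonic_mapping_on (ball 0 1) f \<and>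
         bdd_above ((\<lambda>z. (1 - (norm z)\<^sup>2) * Lambda f z) ` ball 0 1)}"

text \<open>Only meaningful for members of \<^const>\<open>harmonic_Bloch\<close>, for which the supremum is finite.\<close>

definition Bloch_norm :: "(complex \<Rightarrow> complex) \<Rightarrow> real" where
  "Bloch_norm f = (SUP z\<in>ball 0 1. (1 - (norm z)\<^sup>2) * Lambda f z)"

definition disk_aut :: "complex \<Rightarrow> complex \<Rightarrow> complex" where
  "disk_aut w z = (w - z) / (1 - cnj w * z)"

definition pseudo_hyp_dist :: "complex \<Rightarrow> complex \<Rightarrow> real" where
  "pseudo_hyp_dist z w = norm (disk_aut w z)"

end

theory Submission
  imports Defs "HOL-Complex_Analysis.Complex_Analysis"
begin

text \<open>
  A harmonic mapping of the disk is \<open>h + cnj g\<close> with \<open>h\<close>, \<open>g\<close> holomorphic, so that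
  \<open>H = ddz f\<close> and \<open>G = cnj (ddzbar f)\<close> are holomorphic and \<open>Lambda f\<close> is \<open>\<bar>H\<bar> + \<bar>G\<bar>\<close>.
  This sum is the maximum of \<open>\<bar>H + c G\<bar>\<close> over the unimodular constants \<open>c\<close>. A maximum of
  functions that are Lipschitz with one common constant is Lipschitz with the same constant, and
  each \<open>H + c G\<close> satisfies the growth bound of \<open>f\<close>. Hence it suffices to treat a single
  holomorphic \<open>F\<close> with \<open>(1 - \<bar>z\<bar>\<^sup>2) \<bar>F z\<bar> \<le> M\<close>, and nothing is lost in passing from the
  analytic to the harmonic case.

  For such an \<open>F\<close> the constant \<open>5\<close> works (\<open>weighted_modulus_Lipschitz\<close>). The expression
  \<open>(1 - \<bar>z\<bar>\<^sup>2) \<bar>F z\<bar>\<close> is invariant when \<open>F\<close> is transported, as a derivative, by a disk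
  automorphism, so \<open>w\<close> may be moved to the origin, where the pseudo-hyperbolic distance to
  \<open>z\<close> becomes \<open>\<bar>z\<bar>\<close>. If \<open>\<bar>z\<bar> \<ge> 1/5\<close>, the claim is trivial because both weighted values lie
  between \<open>0\<close> and \<open>M\<close>. For smaller \<open>\<bar>z\<bar>\<close>, the Schwarz lemma on the disk of radius \<open>1/2\<close>
  bounds \<open>\<bar>F z - F 0\<bar>\<close> by \<open>(14/3) \<bar>z\<bar> M\<close>, and the weight contributes only a term of order
  \<open>\<bar>z\<bar>\<^sup>2\<close>.

  That \<open>H\<close> is holomorphic is the Cauchy--Riemann equation \<open>ddzbar (ddz f) = 0\<close>. For \<open>G\<close>,
  subtracting from \<open>f\<close> a primitive \<open>h\<close> of \<open>H\<close> and conjugating gives a function that again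
  satisfies the Cauchy--Riemann equations and has derivative \<open>G\<close>.
\<close>

section \<open>Holomorphic functions of Bloch growth\<close>

text \<open>
  On the disk of radius \<open>1/2\<close> the growth bound gives \<open>\<bar>K\<bar> \<le> (4/3) M\<close>, and \<open>\<bar>K 0\<bar> \<le> M\<close>. The
  difference is thus at most \<open>(7/3) M\<close> there, and the Schwarz lemma gains the factor \<open>2 \<bar>z\<bar>\<close>.
\<close>

lemma holomorphic_increment_at_zero:
  fixes K :: "complex \<Rightarrow> complex"
  assumes hol: "K holomorphic_on ball 0 1"
    and bound: "\<And>\<zeta>. norm \<zeta> < 1 \<Longrightarrow> (1 - (norm \<zeta>)\<^sup>2) * norm (K \<zeta>) \<le> M"
    and z: "norm z < 1 / 2"
  shows "norm (K z - K 0) \<le> 14 / 3 * norm z * M"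
proof (cases "M \<le> 0")
  case True
  have "K \<zeta> = 0" if "norm \<zeta> < 1" for \<zeta>
  proof -
    have "(1 - (norm \<zeta>)\<^sup>2) > 0" using that by (simp add: abs_square_less_1)
    moreover have "(1 - (norm \<zeta>)\<^sup>2) * norm (K \<zeta>) \<le> 0" using bound[OF that] True by linarith
    ultimately show ?thesis by (simp add: mult_le_0_iff)
  qed
  moreover have "M \<ge> 0" using bound[of 0] norm_ge_zero[of "K 0"] by (simp del: norm_ge_zero)
  ultimately show ?thesis using z by simp
next
  case False
  then have M: "M > 0" by simp
  define B where "B = 7 / 3 * M"
  have B: "B > 0" using M by (simp add: B_def)
  define k where "k = (\<lambda>\<zeta>. (K (\<zeta> / 2) - K 0) / of_real B)"
  have "(K \<circ> (\<lambda>\<zeta>. \<zeta> / 2)) holomorphic_on ball 0 1"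
    by (rule holomorphic_on_compose_gen[OF _ hol]) (auto intro!: holomorphic_intros simp: norm_divide)
  then have holk: "k holomorphic_on ball 0 1"
    unfolding k_def o_def using B by (auto intro!: holomorphic_intros)
  have k1: "norm (k \<zeta>) < 1" if \<zeta>: "norm \<zeta> < 1" for \<zeta>
  proof -
    have sq: "(norm \<zeta>)\<^sup>2 < 1" using \<zeta> by (simp add: abs_square_less_1)
    \<comment> \<open>The Schwarz lemma asks for a strict bound; it comes from \<open>\<bar>\<zeta>\<bar> < 1\<close>.\<close>
    have "norm (K (\<zeta> / 2)) < 4 / 3 * M"
    proof (cases "K (\<zeta> / 2) = 0")
      case False
      have "3 / 4 * norm (K (\<zeta> / 2)) < (1 - (norm (\<zeta> / 2))\<^sup>2) * norm (K (\<zeta> / 2))"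
        using sq False by (intro mult_strict_right_mono) (auto simp: norm_divide power_divide)
      also have "\<dots> \<le> M" using \<zeta> by (intro bound) (simp add: norm_divide)
      finally show ?thesis by simp
    qed (use M in simp)
    moreover have "norm (K 0) \<le> M" using bound[of 0] by simp
    ultimately have "norm (K (\<zeta> / 2) - K 0) < B"
      using norm_triangle_ineq4[of "K (\<zeta> / 2)" "K 0"] unfolding B_def by linarith
    then show ?thesis using B by (simp add: k_def norm_divide)
  qed
  have "norm (k (2 * z)) \<le> norm (2 * z)"
    by (rule Schwarz_Lemma(1)[OF holk _ k1]) (use z in \<open>auto simp: k_def norm_mult\<close>)
  then have "B * norm (k (2 * z)) \<le> B * (2 * norm z)"
    using B by (simp add: norm_mult)
  moreover have "norm (K z - K 0) = B * norm (k (2 * z))"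
    using B by (simp add: k_def norm_divide)
  ultimately show ?thesis by (simp add: B_def mult_ac)
qed

text \<open>
  The threshold \<open>\<bar>z\<bar> = 1/5\<close> is where the trivial bound \<open>M\<close> equals \<open>5 \<bar>z\<bar> M\<close>. Below it the weight
  is at least \<open>24/25\<close>, so the term \<open>\<bar>z\<bar>\<^sup>2 \<bar>K z\<bar>\<close> is at most \<open>(5/24) \<bar>z\<bar> M\<close>, and
  \<open>14/3 + 5/24 < 5\<close>.
\<close>

lemma weighted_modulus_increment_at_zero:
  fixes K :: "complex \<Rightarrow> complex"
  assumes hol: "K holomorphic_on ball 0 1"
    and bound: "\<And>\<zeta>. norm \<zeta> < 1 \<Longrightarrow> (1 - (norm \<zeta>)\<^sup>2) * norm (K \<zeta>) \<le> M"
    and z: "norm z < 1"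
  shows "\<bar>(1 - (norm z)\<^sup>2) * norm (K z) - norm (K 0)\<bar> \<le> 5 * norm z * M"
proof -
  define r where "r = norm z"
  have r: "0 \<le> r" "r < 1" using z by (auto simp: r_def)
  then have r2: "r\<^sup>2 < 1" by (simp add: abs_square_less_1)
  have w: "0 \<le> (1 - r\<^sup>2) * norm (K z)" "(1 - r\<^sup>2) * norm (K z) \<le> M"
    using bound[OF z] r2 by (auto simp: r_def)
  have "norm (K 0) \<le> M" using bound[of 0] by simp
  then have 0: "0 \<le> norm (K 0)" "norm (K 0) \<le> M" "0 \<le> M" by (simp, simp, meson norm_ge_zero order_trans)
  show ?thesis
  proof (cases "r < 1 / 5")
    case False
    then have "1 * M \<le> 5 * r * M" using 0 by (intro mult_right_mono) auto
    then show ?thesis using w 0 unfolding r_def by linarith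
  next
    case True
    have d: "norm (K z - K 0) \<le> 14 / 3 * r * M"
      unfolding r_def using True
      by (intro holomorphic_increment_at_zero[OF hol bound]) (auto simp: r_def)
    have r2': "r\<^sup>2 \<le> r / 5"
      using True r unfolding power2_eq_square by (metis less_eq_real_def mult.commute mult_left_mono times_divide_eq_right mult.right_neutral)
    have "norm (K z) \<le> 25 / 24 * M"
    proof -
      have "24 / 25 * norm (K z) \<le> (1 - r\<^sup>2) * norm (K z)"
        using r2' True by (intro mult_right_mono) auto
      then show ?thesis using w by simp
    qed
    then have "r\<^sup>2 * norm (K z) \<le> (r / 5) * (25 / 24 * M)"
      using r2' r 0 by (intro mult_mono) auto
    then have e: "r\<^sup>2 * norm (K z) \<le> 5 / 24 * r * M" "0 \<le> r\<^sup>2 * norm (K z)" by (auto simp: mult_ac)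
    have f: "14 / 3 * r * M + 5 / 24 * r * M \<le> 5 * r * M" using r 0 by (simp add: mult_ac)
    have "(1 - r\<^sup>2) * norm (K z) - norm (K 0) = norm (K z) - norm (K 0) - r\<^sup>2 * norm (K z)"
      by (simp add: algebra_simps)
    then show ?thesis
      using d e f norm_triangle_ineq3[of "K z" "K 0"] unfolding r_def abs_le_iff by linarith
  qed
qed

lemma disk_aut_denominator_nonzero:
  assumes "norm w < 1" "norm z < 1"
  shows "1 - cnj w * z \<noteq> 0"
proof -
  have "norm (cnj w * z) < 1" using norm_mult_less[of "cnj w" 1 z 1] assms by simp
  then show ?thesis by auto
qed

text \<open>
  The last factor is the modulus of the derivative of \<open>disk_aut w\<close> at \<open>z\<close>: this is the
  Schwarz--Pick identity, which makes \<open>(1 - \<bar>z\<bar>\<^sup>2) \<bar>F z\<bar>\<close> conformally invariant.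
\<close>

lemma one_minus_norm_disk_aut_sq:
  assumes "norm w < 1" "norm z < 1"
  shows "1 - (norm (disk_aut w z))\<^sup>2
    = (1 - (norm z)\<^sup>2) * (norm ((1 - (norm w)\<^sup>2) / (1 - cnj w * z)\<^sup>2))"
proof -
  have n: "norm (1 - cnj w * z) \<noteq> 0" using disk_aut_denominator_nonzero[OF assms] by simp
  have p: "1 - (norm w)\<^sup>2 \<ge> 0" using assms by (simp add: abs_square_le_1)
  have "(norm (1 - cnj w * z))\<^sup>2 - (norm (w - z))\<^sup>2 = (1 - (norm z)\<^sup>2) * (1 - (norm w)\<^sup>2)"
    unfolding cmod_power2 by (simp add: power2_eq_square algebra_simps)
  moreover have "norm (1 - (complex_of_real (norm w))\<^sup>2) = 1 - (norm w)\<^sup>2"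
    using p by (metis abs_of_nonneg norm_of_real of_real_1 of_real_diff of_real_power)
  ultimately show ?thesis
    using n by (simp add: disk_aut_def norm_divide norm_power power_divide divide_simps)
qed

lemma norm_disk_aut_less_1:
  assumes "norm w < 1" "norm z < 1"
  shows "norm (disk_aut w z) < 1"
  using Moebius_function_norm_lt_1[OF assms, of 0]
  by (simp add: Moebius_function_simple disk_aut_def norm_divide norm_minus_commute)

lemma disk_aut_involution:
  assumes "norm w < 1" "norm z < 1"
  shows "disk_aut w (disk_aut w z) = z"
proof -
  have a: "1 - cnj w * z \<noteq> 0" by (rule disk_aut_denominator_nonzero[OF assms])
  have b: "1 - cnj w * w \<noteq> 0" by (rule disk_aut_denominator_nonzero[OF assms(1) assms(1)])
  have "w - disk_aut w z = z * (1 - cnj w * w) / (1 - cnj w * z)"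
    using a by (simp add: disk_aut_def field_simps)
  moreover have "1 - cnj w * disk_aut w z = (1 - cnj w * w) / (1 - cnj w * z)"
    using a by (simp add: disk_aut_def field_simps)
  ultimately show ?thesis using a b by (simp add: disk_aut_def[of w "disk_aut w z"])
qed

lemma pseudo_hyp_dist_commute: "pseudo_hyp_dist z w = pseudo_hyp_dist w z"
proof -
  have "norm (1 - cnj w * z) = norm (1 - cnj z * w)"
    by (metis complex_cnj_cnj complex_cnj_diff complex_cnj_mult complex_cnj_one complex_mod_cnj mult.commute)
  then show ?thesis by (simp add: pseudo_hyp_dist_def disk_aut_def norm_divide norm_minus_commute)
qed

text \<open>
  The involution \<open>disk_aut w\<close> exchanges \<open>0\<close> and \<open>w\<close> and preserves weighted moduli, which reduces
  the claim to base point \<open>0\<close>.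
\<close>

lemma weighted_modulus_Lipschitz:
  fixes F :: "complex \<Rightarrow> complex"
  assumes hol: "F holomorphic_on ball 0 1"
    and bound: "\<And>\<zeta>. norm \<zeta> < 1 \<Longrightarrow> (1 - (norm \<zeta>)\<^sup>2) * norm (F \<zeta>) \<le> M"
    and z: "norm z < 1" and w: "norm w < 1"
  shows "\<bar>(1 - (norm z)\<^sup>2) * norm (F z) - (1 - (norm w)\<^sup>2) * norm (F w)\<bar>
    \<le> 5 * pseudo_hyp_dist z w * M"
proof -
  \<comment> \<open>Up to sign, \<open>K\<close> is the derivative of \<open>\<Phi> \<circ> disk_aut w\<close> for a primitive \<open>\<Phi>\<close> of \<open>F\<close>.\<close>
  define K where "K = (\<lambda>\<zeta>. F (disk_aut w \<zeta>) * ((1 - (norm w)\<^sup>2) / (1 - cnj w * \<zeta>)\<^sup>2))"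
  have weight: "(1 - (norm \<zeta>)\<^sup>2) * norm (K \<zeta>)
      = (1 - (norm (disk_aut w \<zeta>))\<^sup>2) * norm (F (disk_aut w \<zeta>))" if "norm \<zeta> < 1" for \<zeta>
    unfolding one_minus_norm_disk_aut_sq[OF w that] K_def norm_mult by (simp add: mult_ac)
  have "(F \<circ> disk_aut w) holomorphic_on ball 0 1"
  proof (rule holomorphic_on_compose_gen[OF _ hol])
    show "disk_aut w holomorphic_on ball 0 1"
      unfolding disk_aut_def[abs_def]
      using disk_aut_denominator_nonzero[OF w] by (auto intro!: holomorphic_intros)
    show "disk_aut w ` ball 0 1 \<subseteq> ball 0 1"
      using norm_disk_aut_less_1[OF w] by auto
  qed
  then have "K holomorphic_on ball 0 1"
    unfolding K_def o_def using disk_aut_denominator_nonzero[OF w]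
    by (auto intro!: holomorphic_intros)
  moreover have "(1 - (norm \<zeta>)\<^sup>2) * norm (K \<zeta>) \<le> M" if "norm \<zeta> < 1" for \<zeta>
    using weight[OF that] bound[OF norm_disk_aut_less_1[OF w that]] by simp
  ultimately have "\<bar>(1 - (norm (disk_aut w z))\<^sup>2) * norm (K (disk_aut w z)) - norm (K 0)\<bar>
      \<le> 5 * norm (disk_aut w z) * M"
    using norm_disk_aut_less_1[OF w z] by (rule weighted_modulus_increment_at_zero)
  moreover have "norm (K 0) = (1 - (norm w)\<^sup>2) * norm (F w)"
    using weight[of 0] by (simp add: disk_aut_def)
  ultimately show ?thesis
    using weight[OF norm_disk_aut_less_1[OF w z]]
    by (simp add: disk_aut_involution[OF w z] pseudo_hyp_dist_def)
qed

section \<open>Continuous partial derivatives and the Cauchy--Riemann equations\<close>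

text \<open>
  Existence of the partial derivatives alone does not give total differentiability; their
  continuity does, on a square inside \<open>S\<close> on which \<open>u\<close> is a function of two real variables.
\<close>

lemma C1_on_has_derivative:
  assumes "open S" "C1_on S u" "z \<in> S"
  shows "(u has_derivative (\<lambda>h. Re h *\<^sub>R ddx u z + Im h *\<^sub>R ddy u z)) (at z)"
proof -
  obtain d where d: "d > 0" "ball z d \<subseteq> S" using assms openE by blast
  define X where "X = {Re z - d / 2<..<Re z + d / 2}"
  define Y where "Y = {Im z - d / 2<..<Im z + d / 2}"
  have XY: "Complex x y \<in> S" if "x \<in> X" "y \<in> Y" for x y
  proof -
    have "norm (z - Complex x y) \<le> \<bar>Re (z - Complex x y)\<bar> + \<bar>Im (z - Complex x y)\<bar>"
      by (rule cmod_le)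
    also have "\<dots> < d" using that by (auto simp: X_def Y_def)
    finally show ?thesis using d by (auto simp: dist_norm)
  qed
  have z_in: "Re z \<in> X" "Im z \<in> Y" using d by (auto simp: X_def Y_def)
  have op: "open X" "open Y" "convex Y" by (auto simp: X_def Y_def)
  have shift: "(g has_vector_derivative D) (at a)"
    if "((\<lambda>t. g (a + t)) has_vector_derivative D) (at 0)" for g :: "real \<Rightarrow> complex" and D a
  proof -
    have "((\<lambda>t. t - a) has_vector_derivative 1) (at a)"
      by (auto intro!: derivative_eq_intros)
    from vector_diff_chain_at[OF this, of "\<lambda>t. g (a + t)" D] show ?thesis
      using that by (simp add: o_def)
  qed
  have px: "((\<lambda>x. u (Complex x y)) has_vector_derivative ddx u (Complex x y)) (at x)"
    if "Complex x y \<in> S" for x y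
  proof (rule shift)
    have "(\<lambda>t::real. u (Complex x y + of_real t)) differentiable (at 0)"
      using assms(2) that by (auto simp: C1_on_def)
    moreover have "Complex x y + of_real t = Complex (x + t) y" for t
      by (simp add: complex_eq_iff)
    ultimately show "((\<lambda>t. u (Complex (x + t) y)) has_vector_derivative ddx u (Complex x y)) (at 0)"
      unfolding ddx_def vector_derivative_works by simp
  qed
  have py: "((\<lambda>y. u (Complex x y)) has_vector_derivative ddy u (Complex x y)) (at y)"
    if "Complex x y \<in> S" for x y
  proof (rule shift)
    have "(\<lambda>t::real. u (Complex x y + \<i> * of_real t)) differentiable (at 0)"
      using assms(2) that by (auto simp: C1_on_def)
    moreover have "Complex x y + \<i> * of_real t = Complex x (y + t)" for t
      by (simp add: complex_eq_iff)
    ultimately show "((\<lambda>t. u (Complex x (y + t))) has_vector_derivative ddy u (Complex x y)) (at 0)"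
      unfolding ddy_def vector_derivative_works by simp
  qed
  have "((\<lambda>(x, y). u (Complex x y)) has_derivative
      (\<lambda>(tx, ty). tx *\<^sub>R ddx u z + blinfun_scaleR_left (ddy u (Complex (Re z) (Im z))) ty))
      (at (Re z, Im z) within X \<times> Y)"
  proof (rule has_derivative_partialsI)
    show "((\<lambda>x. u (Complex x (Im z))) has_derivative (\<lambda>tx. tx *\<^sub>R ddx u z)) (at (Re z) within X)"
      using px[of "Re z" "Im z"] assms(3)
      by (auto simp: has_vector_derivative_def intro: has_derivative_at_withinI)
    show "((\<lambda>y. u (Complex x y)) has_derivative
        blinfun_apply (blinfun_scaleR_left (ddy u (Complex x y)))) (at y within Y)"
      if "x \<in> X" "y \<in> Y" for x y
      using py[OF XY[OF that]]
      by (auto simp: has_vector_derivative_def intro: has_derivative_at_withinI)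
    have "continuous_on (X \<times> Y) (\<lambda>p. ddy u (Complex (fst p) (snd p)))"
      by (rule continuous_on_compose2[of S "ddy u"])
        (use assms(2) XY in \<open>auto simp: C1_on_def intro!: continuous_intros\<close>)
    then have "continuous_on (X \<times> Y) (\<lambda>p. blinfun_scaleR_left (ddy u (Complex (fst p) (snd p))))"
      by (rule bounded_linear.continuous_on[OF bounded_linear_blinfun_scaleR_left])
    then show "continuous (at (Re z, Im z) within X \<times> Y)
        (\<lambda>(x, y). blinfun_scaleR_left (ddy u (Complex x y)))"
      using z_in
      by (simp add: continuous_on_eq_continuous_within case_prod_unfold)
  qed (use z_in op in auto)
  moreover have "at (Re z, Im z) within X \<times> Y = at (Re z, Im z)"
    using z_in op by (intro at_within_open) (auto intro: open_Times)
  ultimately have D: "((\<lambda>(x, y). u (Complex x y)) has_derivative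
      (\<lambda>(tx, ty). tx *\<^sub>R ddx u z + ty *\<^sub>R ddy u z)) (at (Re z, Im z))"
    by simp
  have "((\<lambda>p. (Re p, Im p)) has_derivative (\<lambda>h. (Re h, Im h))) (at z)"
    by (auto intro!: derivative_eq_intros)
  from has_derivative_compose[OF this D] show ?thesis by simp
qed

lemma C1_on_Cauchy_Riemann_has_field_derivative:
  assumes "open S" "C1_on S u" "z \<in> S" "ddzbar u z = 0"
  shows "(u has_field_derivative ddz u z) (at z)"
proof -
  have i: "\<i> * ddy u z = - ddx u z"
    using assms(4) by (simp add: ddzbar_def eq_neg_iff_add_eq_0 add.commute)
  then have y: "ddy u z = \<i> * ddx u z"
    by (metis complex_i_mult_minus minus_minus)
  have "ddz u z = ddx u z" by (simp add: ddz_def i)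
  moreover have "Re h *\<^sub>R ddx u z + Im h *\<^sub>R ddy u z = ddx u z * h" for h
    unfolding y by (simp add: complex_eq_iff algebra_simps)
  ultimately show ?thesis
    using C1_on_has_derivative[OF assms(1-3)] by (simp add: has_field_derivative_def)
qed

lemma C1_on_Cauchy_Riemann_holomorphic:
  assumes "open S" "C1_on S u" "\<And>z. z \<in> S \<Longrightarrow> ddzbar u z = 0"
  shows "u holomorphic_on S"
  using C1_on_Cauchy_Riemann_has_field_derivative[OF assms(1,2)] assms
  by (auto simp: holomorphic_on_open)

text \<open>
  The chain rule along the two axes. It is how the partial derivatives of sums, products and
  conjugates are computed below: their total derivatives come from the derivative calculus.
\<close>

lemma partials_of_has_derivative:
  assumes "(u has_derivative D) (at z)"
  shows "((\<lambda>t::real. u (z + of_real t)) has_vector_derivative D 1) (at 0)"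
    and "((\<lambda>t::real. u (z + \<i> * of_real t)) has_vector_derivative D \<i>) (at 0)"
    and "ddx u z = D 1" and "ddy u z = D \<i>"
proof -
  have lin: "D (t *\<^sub>R k) = t *\<^sub>R D k" for t k
    using has_derivative_linear[OF assms] by (rule linear_cmul)
  have line: "((\<lambda>t::real. u (z + t *\<^sub>R k)) has_vector_derivative D k) (at 0)" for k
  proof -
    have "((\<lambda>t::real. z + t *\<^sub>R k) has_derivative (\<lambda>t. t *\<^sub>R k)) (at 0)"
      by (auto intro!: derivative_eq_intros)
    from has_derivative_compose[OF this, of u D] show ?thesis
      using assms by (simp add: has_vector_derivative_def lin)
  qed
  show x: "((\<lambda>t::real. u (z + of_real t)) has_vector_derivative D 1) (at 0)"
    using line[of 1] by (simp add: scaleR_conv_of_real)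
  show y: "((\<lambda>t::real. u (z + \<i> * of_real t)) has_vector_derivative D \<i>) (at 0)"
    using line[of \<i>] by (simp add: scaleR_conv_of_real mult.commute)
  show "ddx u z = D 1" unfolding ddx_def by (rule vector_derivative_at[OF x])
  show "ddy u z = D \<i>" unfolding ddy_def by (rule vector_derivative_at[OF y])
qed

text \<open>
  Conjugation exchanges \<open>ddz\<close> and \<open>ddzbar\<close>, and subtracting a holomorphic \<open>h\<close> changes only
  \<open>ddz\<close>. When \<open>H = ddz u\<close>, the result satisfies the Cauchy--Riemann equations and its derivative
  is the conjugate of \<open>ddzbar u\<close>.
\<close>

lemma C1_on_cnj_diff_primitive:
  assumes S: "open S" and u: "C1_on S u"
    and h: "\<And>z. z \<in> S \<Longrightarrow> (h has_field_derivative H z) (at z)"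
    and H: "continuous_on S H"
  defines "v \<equiv> \<lambda>z. cnj (u z - h z)"
  shows "C1_on S v"
    and "\<And>z. z \<in> S \<Longrightarrow> ddz v z = cnj (ddzbar u z)"
    and "\<And>z. z \<in> S \<Longrightarrow> ddzbar v z = cnj (ddz u z - H z)"
proof -
  have D: "(v has_derivative (\<lambda>k. cnj (Re k *\<^sub>R ddx u z + Im k *\<^sub>R ddy u z - H z * k))) (at z)"
    if "z \<in> S" for z
    unfolding v_def using C1_on_has_derivative[OF S u that] h[OF that]
    by (intro has_derivative_cnj has_derivative_diff) (auto simp: has_field_derivative_def)
  have x: "ddx v z = cnj (ddx u z - H z)" and y: "ddy v z = cnj (ddy u z - \<i> * H z)"
    if "z \<in> S" for z
    using partials_of_has_derivative(3,4)[OF D[OF that]] by (simp_all add: mult.commute)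
  have "continuous_on S (ddx v)"
    using u H by (subst continuous_on_cong[OF refl x])
      (auto simp: C1_on_def intro!: continuous_intros)
  moreover have "continuous_on S (ddy v)"
    using u H by (subst continuous_on_cong[OF refl y])
      (auto simp: C1_on_def intro!: continuous_intros)
  ultimately show "C1_on S v"
    using partials_of_has_derivative(1,2)[OF D] unfolding C1_on_def
    by (blast intro: differentiableI_vector)
  show "ddz v z = cnj (ddzbar u z)" "ddzbar v z = cnj (ddz u z - H z)" if "z \<in> S" for z
    unfolding ddz_def ddzbar_def x[OF that] y[OF that]
    by (simp_all add: complex_eq_iff)
qed

lemma C1_on_ddz:
  assumes "C1_on S (ddx f)" "C1_on S (ddy f)" "open S"
  shows "C1_on S (ddz f)"
proof -
  have D: "(ddz f has_derivative (\<lambda>k. ((Re k *\<^sub>R ddx (ddx f) z + Im k *\<^sub>R ddy (ddx f) z)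
      - \<i> * (Re k *\<^sub>R ddx (ddy f) z + Im k *\<^sub>R ddy (ddy f) z)) / 2)) (at z)" if "z \<in> S" for z
    unfolding ddz_def[abs_def]
    by (intro bounded_linear.has_derivative[OF bounded_linear_divide] has_derivative_diff has_derivative_mult_right
        C1_on_has_derivative[OF assms(3,1) that] C1_on_has_derivative[OF assms(3,2) that])
  have x: "ddx (ddz f) z = (ddx (ddx f) z - \<i> * ddx (ddy f) z) / 2"
    and y: "ddy (ddz f) z = (ddy (ddx f) z - \<i> * ddy (ddy f) z) / 2" if "z \<in> S" for z
    using partials_of_has_derivative(3,4)[OF D[OF that]] by simp_all
  have "continuous_on S (ddx (ddz f))"
    using assms by (subst continuous_on_cong[OF refl x])
      (auto simp: C1_on_def intro!: continuous_intros)
  moreover have "continuous_on S (ddy (ddz f))"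
    using assms by (subst continuous_on_cong[OF refl y])
      (auto simp: C1_on_def intro!: continuous_intros)
  ultimately show ?thesis
    using partials_of_has_derivative(1,2)[OF D] unfolding C1_on_def
    by (blast intro: differentiableI_vector)
qed

section \<open>The holomorphic parts of a harmonic mapping\<close>

lemma harmonic_mapping_ddz_holomorphic:
  assumes S: "open S" and f: "harmonic_mapping_on S f"
  shows "ddz f holomorphic_on S"
  using f by (intro C1_on_Cauchy_Riemann_holomorphic[OF S] C1_on_ddz)
    (auto simp: harmonic_mapping_on_def C2_on_def laplacian_def S)

text \<open>
  Convexity of \<open>S\<close> provides the primitive \<open>h\<close> of \<open>ddz f\<close>. The function \<open>g = cnj (f - h)\<close> is then
  the conjugate of the antiholomorphic part of \<open>f\<close>, and its derivative is holomorphic.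
\<close>

lemma harmonic_mapping_cnj_ddzbar_holomorphic:
  assumes S: "open S" "convex S" and f: "harmonic_mapping_on S f"
  shows "(\<lambda>z. cnj (ddzbar f z)) holomorphic_on S"
proof -
  have hol: "ddz f holomorphic_on S" by (rule harmonic_mapping_ddz_holomorphic[OF S(1) f])
  obtain h where h: "\<And>z. z \<in> S \<Longrightarrow> (h has_field_derivative ddz f z) (at z)"
    using holomorphic_convex_primitive'[OF S(2,1) hol] S(1) by (metis at_within_open)
  have f1: "C1_on S f" using f by (simp add: harmonic_mapping_on_def C2_on_def)
  note v = C1_on_cnj_diff_primitive[where h = h and H = "ddz f", OF S(1) f1 _
      holomorphic_on_imp_continuous_on[OF hol]]
  define g where "g = (\<lambda>z. cnj (f z - h z))"
  have g1: "C1_on S g" unfolding g_def by (rule v(1)[OF h])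
  have g0: "ddzbar g z = 0" if "z \<in> S" for z unfolding g_def by (subst v(3)) (use h that in auto)
  have "g holomorphic_on S" by (rule C1_on_Cauchy_Riemann_holomorphic[OF S(1) g1 g0])
  then have "deriv g holomorphic_on S" by (rule holomorphic_deriv[OF _ S(1)])
  moreover have "ddz g z = cnj (ddzbar f z)" if "z \<in> S" for z
    unfolding g_def by (rule v(2)) (use h that in auto)
  then have "deriv g z = cnj (ddzbar f z)" if "z \<in> S" for z
    using DERIV_imp_deriv[OF C1_on_Cauchy_Riemann_has_field_derivative[OF S(1) g1 that g0[OF that]]]
    by (simp add: that)
  ultimately show ?thesis by (simp cong: holomorphic_cong)
qed

section \<open>The Lipschitz estimate for harmonic Bloch mappings\<close>

lemma unimodular_aligning_factor:
  obtains c :: complex where "norm c = 1" "norm (a + c * b) = norm a + norm b"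
proof (cases "a = 0 \<or> b = 0")
  case True
  then show ?thesis using that[of 1] by auto
next
  case False
  define c where "c = sgn a * cnj (sgn b)"
  have "cnj (sgn b) * b = of_real (norm b)"
    using False complex_norm_square[of b] by (simp add: sgn_eq power2_eq_square field_simps)
  then have "a + c * b = sgn a * of_real (norm a + norm b)"
    using False by (simp add: c_def mult.assoc) (simp add: sgn_eq ring_distribs)
  then have "norm (a + c * b) = norm a + norm b"
    using False by (simp only: norm_mult norm_of_real norm_sgn) auto
  moreover have "norm c = 1" using False by (simp add: c_def norm_mult norm_sgn)
  ultimately show ?thesis using that by blast
qed

theorem theorem1p1:
  fixes f :: "complex \<Rightarrow> complex"
  assumes "f \<in> harmonic_Bloch"
  shows "\<forall>z\<in>ball 0 1. \<forall>w\<in>ball 0 1.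
    \<bar>(1 - (norm z)\<^sup>2) * Lambda f z - (1 - (norm w)\<^sup>2) * Lambda f w\<bar>
      \<le> 5.7174 * pseudo_hyp_dist z w * Bloch_norm f"
proof -
  define M where "M = Bloch_norm f"
  define G where "G = (\<lambda>z. cnj (ddzbar f z))"
  have harm: "harmonic_mapping_on (ball 0 1) f"
    and bdd: "bdd_above ((\<lambda>z. (1 - (norm z)\<^sup>2) * Lambda f z) ` ball 0 1)"
    using assms by (auto simp: harmonic_Bloch_def)
  have holH: "ddz f holomorphic_on ball 0 1" and holG: "G holomorphic_on ball 0 1"
    unfolding G_def using harm
    by (auto intro: harmonic_mapping_ddz_holomorphic harmonic_mapping_cnj_ddzbar_holomorphic)
  have Lambda_G: "Lambda f z = norm (ddz f z) + norm (G z)" for z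
    by (simp add: Lambda_def G_def)
  have weight: "0 \<le> 1 - (norm z)\<^sup>2" if "norm z < 1" for z :: complex
    using that by (simp add: abs_square_le_1)
  have le_M: "(1 - (norm z)\<^sup>2) * Lambda f z \<le> M" if "norm z < 1" for z
    unfolding M_def Bloch_norm_def using that by (intro cSUP_upper[OF _ bdd]) auto
  have M: "0 \<le> M"
    using le_M[of 0] by (simp add: Lambda_def) (meson add_nonneg_nonneg norm_ge_zero order_trans)
  have one_sided: "(1 - (norm z)\<^sup>2) * Lambda f z - (1 - (norm w)\<^sup>2) * Lambda f w
      \<le> 5 * pseudo_hyp_dist z w * M" if z: "norm z < 1" and w: "norm w < 1" for z w
  proof -
    \<comment> \<open>The constant \<open>c\<close> is chosen to make \<open>\<bar>F\<bar>\<close> equal to \<open>Lambda f\<close> at \<open>z\<close>; at \<open>w\<close> the inequality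
        \<open>\<bar>F\<bar> \<le> Lambda f\<close> has the right direction for the one-sided estimate.\<close>
    obtain c where c: "norm c = 1" "norm (ddz f z + c * G z) = Lambda f z"
      unfolding Lambda_G by (rule unimodular_aligning_factor)
    define F where "F = (\<lambda>\<zeta>. ddz f \<zeta> + c * G \<zeta>)"
    have F_le: "(1 - (norm \<zeta>)\<^sup>2) * norm (F \<zeta>) \<le> (1 - (norm \<zeta>)\<^sup>2) * Lambda f \<zeta>"
      if "norm \<zeta> < 1" for \<zeta>
      using norm_triangle_ineq[of "ddz f \<zeta>" "c * G \<zeta>"] c(1) weight[OF that]
      by (intro mult_left_mono) (auto simp: F_def Lambda_G norm_mult)
    have "F holomorphic_on ball 0 1"
      unfolding F_def using holH holG by (intro holomorphic_intros)
    moreover have "(1 - (norm \<zeta>)\<^sup>2) * norm (F \<zeta>) \<le> M" if "norm \<zeta> < 1" for \<zeta>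
      using F_le[OF that] le_M[OF that] by linarith
    ultimately have "\<bar>(1 - (norm z)\<^sup>2) * norm (F z) - (1 - (norm w)\<^sup>2) * norm (F w)\<bar>
        \<le> 5 * pseudo_hyp_dist z w * M"
      using z w by (rule weighted_modulus_Lipschitz)
    then show ?thesis using c(2) F_le[OF w] by (simp add: F_def)
  qed
  show ?thesis
  proof (intro ballI)
    fix z w :: complex assume "z \<in> ball 0 1" "w \<in> ball 0 1"
    then have z: "norm z < 1" and w: "norm w < 1" by auto
    have "\<bar>(1 - (norm z)\<^sup>2) * Lambda f z - (1 - (norm w)\<^sup>2) * Lambda f w\<bar>
        \<le> 5 * pseudo_hyp_dist z w * M"
      using one_sided[OF z w] one_sided[OF w z]
      by (simp add: abs_le_iff pseudo_hyp_dist_commute[of w z])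
    also have "\<dots> \<le> 5.7174 * pseudo_hyp_dist z w * M"
      using M by (intro mult_right_mono) (auto simp: pseudo_hyp_dist_def)
    finally show "\<bar>(1 - (norm z)\<^sup>2) * Lambda f z - (1 - (norm w)\<^sup>2) * Lambda f w\<bar>
        \<le> 5.7174 * pseudo_hyp_dist z w * Bloch_norm f"
      by (simp add: M_def)
  qed
qed

end
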